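(* Let $R$ be a commutative ring and $X$ an indeterminate over $R$. Then the following are equivalent, both when "P" is read throughout as "atoms of $R[X]$" and when "P" is read throughout as "indecomposable elements of $R[X]$": (1) $R$ is a finite direct product of indecomposable rings. (2) $X$ is a finite product of P. (3) Each $X^n$, $n\ge 1$, is a finite product of P. (4) Some $X^n$, $n\ge 1$, is a finite product of P. Moreover, in this case $X$ can be written uniquely, up to order and multiplication by units of $R[X]$, as a finite product of atoms (resp., of nonunit indecomposable elements) of $R[X]$.
   Context: All rings are commutative with identity $1\neq 0$. A ring is indecomposable if it is not a direct product of two nonzero rings (equivalently, its only idempotents are $0$ and $1$). Finite direct products have at least one factor. For elements $a,b$ of a ring $A$: $a\sim b$ (associates) means $Aa=Ab$; $a\approx b$ (strong associates) means $a=ub$ for some unit $u\in A$. A nonunit $a\in A$ is irreducible, or an atom, if $a=bc$ with $b,c\in A$ implies $a\sim b$ or $a\sim c$. A polynomial $f\in R[X]$ is an indecomposable element of $R[X]$ if whenever $f=gh$ with $g,h\in R[X]$, there is some $a\in R$ with $g\approx a$ or $h\approx a$ in $R[X]$ (units of $R[X]$ satisfy this condition). *)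

theory Defs
  imports
    "HOL-Algebra.Chinese_Remainder"
    "HOL-Algebra.Algebraic_Closure_Type"
    "HOL-Computational_Algebra.Polynomial"
    "HOL-Library.Multiset"
begin

text \<open>
  The ring \<open>R\<close> is a type of class \<^class>\<open>comm_ring_1\<close> (so \<open>0 \<noteq> 1\<close>), \<open>R[X]\<close> is the type
  of polynomials over it, and units are the divisors of \<open>1\<close>. Only the direct product
  decomposition of \<open>R\<close> needs rings as objects; there \<open>R\<close> is viewed as the record
  \<^const>\<open>ring_of_type_algebra\<close>, whose carrier is the whole type.
\<close>

text \<open>
  The factors \<open>A\<close>, \<open>B\<close> range over rings whose carrier is a subset of the type of \<open>S\<close>. This is no
  restriction: in any decomposition of \<open>S\<close>, a factor \<open>A\<close> is in bijection with the subset of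
  \<open>carrier S\<close> that corresponds to \<open>A \<times> {0}\<close>, and its structure can be transported there.
\<close>

definition indecomposable_ring :: "'b ring \<Rightarrow> bool" where
  "indecomposable_ring S \<longleftrightarrow>
     cring S \<and> \<one>\<^bsub>S\<^esub> \<noteq> \<zero>\<^bsub>S\<^esub> \<and>
     \<not> (\<exists>(A :: 'b ring) (B :: 'b ring). cring A \<and> \<one>\<^bsub>A\<^esub> \<noteq> \<zero>\<^bsub>A\<^esub> \<and> cring B \<and> \<one>\<^bsub>B\<^esub> \<noteq> \<zero>\<^bsub>B\<^esub> \<and> S \<simeq> RDirProd A B)"

text \<open>The choice of carrier type for the factors is harmless for the same reason.\<close>

definition finite_product_of_indecomposable_rings :: "'a::comm_ring_1 itself \<Rightarrow> bool" where
  "finite_product_of_indecomposable_rings _ \<longleftrightarrow>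
     (\<exists>Ss :: 'a ring list. Ss \<noteq> [] \<and> (\<forall>S \<in> set Ss. indecomposable_ring S) \<and>
        (ring_of_type_algebra :: 'a ring) \<simeq> RDirProd_list Ss)"

definition associates :: "'a::comm_ring_1 \<Rightarrow> 'a \<Rightarrow> bool" where
  "associates a b \<longleftrightarrow> range (\<lambda>r. r * a) = range (\<lambda>r. r * b)"

definition strong_associates :: "'a::comm_ring_1 \<Rightarrow> 'a \<Rightarrow> bool" where
  "strong_associates a b \<longleftrightarrow> (\<exists>u. u dvd 1 \<and> a = u * b)"

text \<open>
  In a ring with zero divisors this is weaker than the library's notion of irreducibility (of
  Factorial\_Ring), which asks for one of the two factors to be a unit; \<open>0\<close> is not excluded
  either.
\<close>

definition is_atom :: "'a::comm_ring_1 \<Rightarrow> bool" where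
  "is_atom a \<longleftrightarrow> \<not> a dvd 1 \<and> (\<forall>b c. a = b * c \<longrightarrow> associates a b \<or> associates a c)"

definition indecomposable_poly :: "'a::comm_ring_1 poly \<Rightarrow> bool" where
  "indecomposable_poly f \<longleftrightarrow>
     (\<forall>g h. f = g * h \<longrightarrow> (\<exists>a. strong_associates g [:a:] \<or> strong_associates h [:a:]))"

definition finite_product_of :: "('a::comm_ring_1 \<Rightarrow> bool) \<Rightarrow> 'a \<Rightarrow> bool" where
  "finite_product_of P x \<longleftrightarrow> (\<exists>F. (\<forall>f \<in># F. P f) \<and> x = prod_mset F)"

text \<open>
  Factorizations are multisets, hence unordered; \<^const>\<open>rel_mset\<close> matches two of them up bijectively,
  corresponding factors differing by a unit.
\<close>

definition unique_finite_product_of :: "('a::comm_ring_1 \<Rightarrow> bool) \<Rightarrow> 'a \<Rightarrow> bool" where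
  "unique_finite_product_of P x \<longleftrightarrow>
     finite_product_of P x \<and>
     (\<forall>F G. (\<forall>f \<in># F. P f) \<and> x = prod_mset F \<and> (\<forall>g \<in># G. P g) \<and> x = prod_mset G
        \<longrightarrow> rel_mset strong_associates F G)"

abbreviation poly_X :: "'a::comm_ring_1 poly" where
  "poly_X \<equiv> [:0, 1:]"

end

theory Submission
  imports Defs
begin

text \<open>
  Each ring-theoretic condition is compared with the existence of a finite complete system \<open>E\<close> of
  orthogonal primitive idempotents of \<open>R\<close>.

  If \<open>R\<close> is a finite product of indecomposable rings, it has only finitely many idempotents, so a
  complete orthogonal system of maximal size exists and its members are primitive. Conversely, a
  system \<open>E\<close> of primitive idempotents gives \<open>R \<cong> \<Prod> e R\<close> with indecomposable factors.

  Given \<open>E\<close>, let \<open>X\<^sub>e = e X + (1 - e)\<close>, which is \<open>X\<close> in the factor \<open>(e R)[X]\<close> and \<open>1\<close> in the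
  complementary one. Then \<open>X = \<Prod> X\<^sub>e\<close>, and every \<open>X\<^sub>e\<close> is irreducible in the strong sense that in
  each factorization one factor is a unit: this is a comparison of the coefficients of degree
  \<open>0\<close> and \<open>1\<close> (\<open>poly_X_on_primitive_irreducible\<close>). So \<open>X\<close> and all its powers are finite products of
  irreducible elements.

  Conversely, suppose \<open>X\<^sup>n\<close>, \<open>n \<ge> 1\<close>, is a product of \<open>m\<close> atoms or indecomposable polynomials.
  Divisors of \<open>X\<^sup>n\<close> are regular, and constants among them are units; therefore each factor is a
  unit or irreducible in the strong sense. An irreducible factor is a nonunit in at most one of the
  factors \<open>(e R)[X]\<close> of a decomposition of \<open>R[X]\<close>, while \<open>X\<^sup>n\<close> is a nonunit in each. So complete
  orthogonal systems have at most \<open>m\<close> members (\<open>card_orthogonal_idempotents_le\<close>), and one of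
  maximal size is primitive.

  The same localization shows uniqueness: an irreducible divisor of \<open>X\<close> that is a nonunit at \<open>e\<close> is a
  unit times \<open>X\<^sub>e\<close>, and \<open>X\<^sub>e\<close> occurs exactly once.
\<close>

section \<open>Localization at an idempotent\<close>

lemma mult_dvd_1_iff: "a * b dvd 1 \<longleftrightarrow> a dvd 1 \<and> b dvd (1 :: 'b::comm_semiring_1)"
  by (metis dvd_mult_left dvd_mult_right mult_1 mult_dvd_mono)

lemma idempotent_left: "e * e = e \<Longrightarrow> e * (e * x) = e * (x :: 'b::comm_ring_1)"
  by (metis mult.assoc)

lemma idempotent_compl: "e * e = e \<Longrightarrow> (1 - e) * (1 - e) = 1 - (e :: 'b::comm_ring_1)"
  by (simp add: algebra_simps)

lemma unit_cancel_left: "u * v = 1 \<Longrightarrow> v * (u * x) = (x :: 'b::comm_ring_1)"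
  by (simp add: mult.commute flip: mult.assoc)

text \<open>
  For idempotent \<open>e\<close>, the element that agrees with \<open>f\<close> in the factor cut out by \<open>e\<close> and with \<open>1\<close>
  in the factor cut out by \<open>1 - e\<close>. Filling up with \<open>1\<close> rather than \<open>0\<close> keeps everything inside
  the given ring: \<open>f\<close> is a unit in the factor of \<open>e\<close> iff \<open>on_part e f\<close> is a unit, and \<open>f\<close> is the
  product of its two parts.
\<close>

definition on_part :: "'b::comm_ring_1 \<Rightarrow> 'b \<Rightarrow> 'b" where
  "on_part e f = e * f + (1 - e)"

lemma on_part_mult: "e * e = e \<Longrightarrow> on_part e (f * g) = on_part e f * on_part e g"
  by (simp add: on_part_def algebra_simps idempotent_left)

lemma on_part_one [simp]: "on_part e 1 = 1"
  by (simp add: on_part_def)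

lemma on_part_zero_left [simp]: "on_part 0 f = 1"
  by (simp add: on_part_def)

lemma on_part_one_left [simp]: "on_part 1 f = f"
  by (simp add: on_part_def)

lemma on_part_on_part: "on_part d (on_part e f) = on_part (d * e) f"
  by (simp add: on_part_def algebra_simps)

lemma on_part_add: "e * d = 0 \<Longrightarrow> on_part (e + d) f = on_part e f * on_part d f"
proof -
  assume *: "e * d = 0"
  then have zero: "d * e = 0" "d * (e * x) = 0" "e * (d * x) = 0" for x
    by (simp_all add: mult.commute mult.left_commute flip: mult.assoc)
  show ?thesis
    by (simp add: on_part_def algebra_simps * zero)
qed

lemma on_part_split: "e * e = e \<Longrightarrow> f = on_part e f * on_part (1 - e) f"
  by (simp add: on_part_def algebra_simps idempotent_left)

lemma on_part_dvd: "e * e = e \<Longrightarrow> f dvd g \<Longrightarrow> on_part e f dvd on_part e g"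
  by (auto simp: on_part_mult elim!: dvdE)

lemma on_part_dvd_1: "e * e = e \<Longrightarrow> f dvd 1 \<Longrightarrow> on_part e f dvd 1"
  using on_part_dvd[of e f 1] by simp

lemma on_part_prod_mset:
  "e * e = e \<Longrightarrow> on_part e (prod_mset F) = (\<Prod>f\<in>#F. on_part e f)"
  by (induction F) (simp_all add: on_part_mult)

lemma prod_mset_dvd_1: "(\<And>f. f \<in># F \<Longrightarrow> f dvd 1) \<Longrightarrow> prod_mset F dvd (1 :: 'b::comm_ring_1)"
  by (induction F) (simp_all add: mult_dvd_1_iff)

text \<open>Hence an irreducible element is a nonunit in at most one of two complementary factors.\<close>

lemma irreducible_on_part:
  assumes "irreducible f" "e * e = e" "\<not> on_part e f dvd 1"
  shows "on_part (1 - e) f dvd 1"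
  using irreducibleD[OF assms(1) on_part_split[OF assms(2)]] assms(3) by simp

section \<open>Systems of orthogonal idempotents\<close>

text \<open>A nonzero idempotent above no idempotents but \<open>0\<close> and itself, in the order \<open>d * e = d\<close>.\<close>

definition primitive_idempotent :: "'b::comm_ring_1 \<Rightarrow> bool" where
  "primitive_idempotent e \<longleftrightarrow>
     e * e = e \<and> e \<noteq> 0 \<and> (\<forall>d. d * d = d \<longrightarrow> d * e = d \<longrightarrow> d = 0 \<or> d = e)"

text \<open>
  A finite complete system: the members are nonzero and pairwise orthogonal, and they sum to \<open>1\<close>.
\<close>

definition orthogonal_idempotents :: "'b::comm_ring_1 set \<Rightarrow> bool" where
  "orthogonal_idempotents E \<longleftrightarrow>
     finite E \<and> (\<forall>e\<in>E. e * e = e \<and> e \<noteq> 0) \<and> (\<forall>e\<in>E. \<forall>d\<in>E. e \<noteq> d \<longrightarrow> e * d = 0)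
     \<and> sum (\<lambda>e. e) E = 1"

lemma orthogonal_idempotents_refine:
  fixes E :: "'b::comm_ring_1 set"
  assumes E: "orthogonal_idempotents E" and e: "e \<in> E" "\<not> primitive_idempotent e"
  shows "\<exists>E' :: 'b set. orthogonal_idempotents E' \<and> card E' = Suc (card E)"
proof -
  from E e obtain d where d: "d * d = d" "d * e = d" "d \<noteq> 0" "d \<noteq> e" and ee: "e * e = e"
    unfolding orthogonal_idempotents_def primitive_idempotent_def by metis
  \<comment> \<open>The member \<open>e\<close> is replaced by the two idempotents \<open>d\<close> and \<open>e - d\<close>.\<close>
  define D where "D = E - {e}"
  have D: "finite D" "\<And>x. x \<in> D \<Longrightarrow> x * x = x \<and> x \<noteq> 0"
      "\<And>x y. x \<in> D \<Longrightarrow> y \<in> D \<Longrightarrow> x \<noteq> y \<Longrightarrow> x * y = 0"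
      "\<And>x. x \<in> D \<Longrightarrow> e * x = 0"
    using E e unfolding orthogonal_idempotents_def D_def by auto
  have sE: "sum (\<lambda>x. x) E = e + sum (\<lambda>x. x) D" and cE: "card E = Suc (card D)"
    using E e(1) sum.remove[of E e "\<lambda>x. x"] card.remove[of E e]
    unfolding orthogonal_idempotents_def D_def by blast+
  have dx: "d * x = 0" if "x \<in> D" for x
    using D(4)[OF that] d(2) by (metis mult.assoc mult_zero_right)
  have ex: "(e - d) * x = 0" if "x \<in> D" for x
    using D(4)[OF that] dx[OF that] by (simp add: algebra_simps)
  have de: "d * (e - d) = 0" and eded: "(e - d) * (e - d) = e - d"
    using d(1,2) ee by (simp_all add: algebra_simps)
  have nd: "d \<notin> D" using dx d by metis
  have ned: "e - d \<notin> D" using ex eded d(4) by (metis eq_iff_diff_eq_0)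
  have dne: "d \<noteq> e - d" using de d by metis
  let ?E = "insert d (insert (e - d) D)"
  have "orthogonal_idempotents ?E"
    unfolding orthogonal_idempotents_def
    using D d de eded dx ex nd ned dne E sE
    by (auto simp: orthogonal_idempotents_def mult.commute)
  moreover have "card ?E = Suc (card E)"
    using nd ned dne D(1) cE by simp
  ultimately show ?thesis by blast
qed

text \<open>
  A system of maximal size has primitive members, for otherwise it could be refined.
\<close>

lemma orthogonal_primitive_idempotents_exist:
  assumes "\<And>E :: 'b::comm_ring_1 set. orthogonal_idempotents E \<Longrightarrow> card E \<le> N"
  shows "\<exists>E :: 'b set. orthogonal_idempotents E \<and> (\<forall>e\<in>E. primitive_idempotent e)"
proof -
  have "orthogonal_idempotents {1 :: 'b}"
    by (simp add: orthogonal_idempotents_def)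
  then have "\<exists>E :: 'b set. orthogonal_idempotents E
      \<and> (\<forall>E' :: 'b set. orthogonal_idempotents E' \<longrightarrow> card E' \<le> card E)"
    by (rule ex_has_greatest_nat[where b = "Suc N"]) (use assms in \<open>auto simp: less_Suc_eq_le\<close>)
  then obtain E :: "'b set" where E: "orthogonal_idempotents E"
      "\<And>E' :: 'b set. orthogonal_idempotents E' \<Longrightarrow> card E' \<le> card E"
    by blast
  have "primitive_idempotent e" if "e \<in> E" for e
  proof (rule ccontr)
    assume "\<not> primitive_idempotent e"
    from orthogonal_idempotents_refine[OF E(1) that this] E(2) show False
      by fastforce
  qed
  with E(1) show ?thesis by blast
qed

lemma sum_orthogonal_left:
  assumes "finite J" "\<And>d. d \<in> J \<Longrightarrow> e * d = (0 :: 'b::comm_ring_1)"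
  shows "e * sum (\<lambda>d. d) J = 0"
  using assms(2) by (auto simp: sum_distrib_left intro: sum.neutral)

section \<open>Idempotents and direct products of rings\<close>

text \<open>
  The ideal generated by an idempotent \<open>e\<close>, as a ring with identity \<open>e\<close>; zero, addition and
  multiplication are those of \<open>S\<close>.
\<close>

definition corner :: "'b ring \<Rightarrow> 'b \<Rightarrow> 'b ring" where
  "corner S e = \<lparr>carrier = (\<lambda>x. e \<otimes>\<^bsub>S\<^esub> x) ` carrier S, monoid.mult = (\<otimes>\<^bsub>S\<^esub>), one = e,
     zero = \<zero>\<^bsub>S\<^esub>, add = (\<oplus>\<^bsub>S\<^esub>)\<rparr>"

lemma corner_simps [simp]:
  "carrier (corner S e) = (\<lambda>x. e \<otimes>\<^bsub>S\<^esub> x) ` carrier S"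
  "x \<otimes>\<^bsub>corner S e\<^esub> y = x \<otimes>\<^bsub>S\<^esub> y" "\<one>\<^bsub>corner S e\<^esub> = e" "\<zero>\<^bsub>corner S e\<^esub> = \<zero>\<^bsub>S\<^esub>"
  "x \<oplus>\<^bsub>corner S e\<^esub> y = x \<oplus>\<^bsub>S\<^esub> y"
  by (simp_all add: corner_def)

text \<open>The idempotent elements of a ring given as a record.\<close>

definition idempotents :: "('b, 'm) ring_scheme \<Rightarrow> 'b set" where
  "idempotents S = {e \<in> carrier S. e \<otimes>\<^bsub>S\<^esub> e = e}"

lemma RDirProd_simps [simp]:
  "carrier (RDirProd A B) = carrier A \<times> carrier B"
  "(a, b) \<otimes>\<^bsub>RDirProd A B\<^esub> (a', b') = (a \<otimes>\<^bsub>A\<^esub> a', b \<otimes>\<^bsub>B\<^esub> b')"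
  "(a, b) \<oplus>\<^bsub>RDirProd A B\<^esub> (a', b') = (a \<oplus>\<^bsub>A\<^esub> a', b \<oplus>\<^bsub>B\<^esub> b')"
  "\<one>\<^bsub>RDirProd A B\<^esub> = (\<one>\<^bsub>A\<^esub>, \<one>\<^bsub>B\<^esub>)"
  "\<zero>\<^bsub>RDirProd A B\<^esub> = (\<zero>\<^bsub>A\<^esub>, \<zero>\<^bsub>B\<^esub>)"
  by (simp_all add: RDirProd_def DirProd_def monoid.defs)

lemma corner_mem:
  assumes "cring S" "e \<in> idempotents S"
  shows "x \<in> carrier (corner S e) \<longleftrightarrow> x \<in> carrier S \<and> e \<otimes>\<^bsub>S\<^esub> x = x"
proof -
  interpret cring S by fact
  have "e \<in> carrier S" "e \<otimes>\<^bsub>S\<^esub> e = e" using assms(2) by (auto simp: idempotents_def)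
  then have "e \<otimes>\<^bsub>S\<^esub> (e \<otimes>\<^bsub>S\<^esub> y) = e \<otimes>\<^bsub>S\<^esub> y" if "y \<in> carrier S" for y
    using that by (metis m_assoc)
  moreover have "x \<in> (\<lambda>y. e \<otimes>\<^bsub>S\<^esub> y) ` carrier S" if "x \<in> carrier S" "e \<otimes>\<^bsub>S\<^esub> x = x"
    using that by (metis imageI)
  ultimately show ?thesis using \<open>e \<in> carrier S\<close> by auto
qed

lemma corner_cring:
  assumes "cring S" "e \<in> idempotents S"
  shows "cring (corner S e)"
proof -
  interpret cring S by fact
  note mem = corner_mem[OF assms]
  have e: "e \<in> carrier S" "e \<otimes>\<^bsub>S\<^esub> e = e" using assms(2) by (auto simp: idempotents_def)
  have ominus: "\<exists>y\<in>carrier (corner S e). y \<oplus>\<^bsub>S\<^esub> x = \<zero>\<^bsub>S\<^esub>" if "x \<in> carrier (corner S e)" for x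
    using that e unfolding mem by (intro bexI[of _ "\<ominus>\<^bsub>S\<^esub> x"]) (auto simp: mem l_neg r_minus simp del: corner_simps(1))
  show ?thesis
  proof (rule cringI)
    show "abelian_group (corner S e)"
    proof (rule abelian_groupI)
      fix x y assume "x \<in> carrier (corner S e)" "y \<in> carrier (corner S e)"
      then show "x \<oplus>\<^bsub>corner S e\<^esub> y \<in> carrier (corner S e)"
        using e by (simp add: mem r_distr del: corner_simps(1))
    qed (use ominus e in \<open>auto simp: mem a_ac simp del: corner_simps(1)\<close>)
    show "Group.comm_monoid (corner S e)"
    proof (rule comm_monoidI)
      fix x y assume "x \<in> carrier (corner S e)" "y \<in> carrier (corner S e)"
      then show "x \<otimes>\<^bsub>corner S e\<^esub> y \<in> carrier (corner S e)"
        using e by (simp add: mem flip: m_assoc del: corner_simps(1))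
    qed (use e in \<open>auto simp: mem m_ac simp del: corner_simps(1)\<close>)
  qed (auto simp: mem l_distr simp del: corner_simps(1))
qed

text \<open>Orthogonal idempotents split a corner ring into a direct product.\<close>

lemma corner_add_iso:
  assumes S: "cring S" and e: "e \<in> idempotents S" and d: "d \<in> idempotents S"
    and ed: "e \<otimes>\<^bsub>S\<^esub> d = \<zero>\<^bsub>S\<^esub>"
  shows "(\<lambda>x. (e \<otimes>\<^bsub>S\<^esub> x, d \<otimes>\<^bsub>S\<^esub> x)) \<in>
    ring_iso (corner S (e \<oplus>\<^bsub>S\<^esub> d)) (RDirProd (corner S e) (corner S d))"
    and "e \<oplus>\<^bsub>S\<^esub> d \<in> idempotents S"
proof -
  interpret cring S by fact
  have e': "e \<in> carrier S" "e \<otimes>\<^bsub>S\<^esub> e = e" and d': "d \<in> carrier S" "d \<otimes>\<^bsub>S\<^esub> d = d"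
    using e d by (auto simp: idempotents_def)
  have de: "d \<otimes>\<^bsub>S\<^esub> e = \<zero>\<^bsub>S\<^esub>" using ed e' d' by (simp add: m_comm)
  show id: "e \<oplus>\<^bsub>S\<^esub> d \<in> idempotents S"
    using e' d' ed de by (simp add: idempotents_def l_distr r_distr)
  have mul: "e \<otimes>\<^bsub>S\<^esub> (e \<otimes>\<^bsub>S\<^esub> x) = e \<otimes>\<^bsub>S\<^esub> x" "d \<otimes>\<^bsub>S\<^esub> (d \<otimes>\<^bsub>S\<^esub> x) = d \<otimes>\<^bsub>S\<^esub> x"
    "e \<otimes>\<^bsub>S\<^esub> (d \<otimes>\<^bsub>S\<^esub> x) = \<zero>\<^bsub>S\<^esub>" "d \<otimes>\<^bsub>S\<^esub> (e \<otimes>\<^bsub>S\<^esub> x) = \<zero>\<^bsub>S\<^esub>" if "x \<in> carrier S" for x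
    using e' d' ed de that by (simp_all flip: m_assoc)
  note mem = corner_mem[OF S e] corner_mem[OF S d] corner_mem[OF S id]
  show "(\<lambda>x. (e \<otimes>\<^bsub>S\<^esub> x, d \<otimes>\<^bsub>S\<^esub> x)) \<in>
    ring_iso (corner S (e \<oplus>\<^bsub>S\<^esub> d)) (RDirProd (corner S e) (corner S d))"
  proof (rule ring_iso_memI)
    fix x assume "x \<in> carrier (corner S (e \<oplus>\<^bsub>S\<^esub> d))"
    then have x: "x \<in> carrier S" by (simp only: mem)
    then show "(e \<otimes>\<^bsub>S\<^esub> x, d \<otimes>\<^bsub>S\<^esub> x) \<in> carrier (RDirProd (corner S e) (corner S d))"
      by simp
    fix y assume "y \<in> carrier (corner S (e \<oplus>\<^bsub>S\<^esub> d))"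
    then have y: "y \<in> carrier S" by (simp only: mem)
    have *: "(c \<otimes>\<^bsub>S\<^esub> x) \<otimes>\<^bsub>S\<^esub> (c \<otimes>\<^bsub>S\<^esub> y) = c \<otimes>\<^bsub>S\<^esub> (x \<otimes>\<^bsub>S\<^esub> y)"
      if "c \<in> carrier S" "c \<otimes>\<^bsub>S\<^esub> c = c" for c
      using that x y by (metis m_assoc m_lcomm m_closed)
    show "(e \<otimes>\<^bsub>S\<^esub> (x \<otimes>\<^bsub>corner S (e \<oplus>\<^bsub>S\<^esub> d)\<^esub> y), d \<otimes>\<^bsub>S\<^esub> (x \<otimes>\<^bsub>corner S (e \<oplus>\<^bsub>S\<^esub> d)\<^esub> y)) =
      (e \<otimes>\<^bsub>S\<^esub> x, d \<otimes>\<^bsub>S\<^esub> x) \<otimes>\<^bsub>RDirProd (corner S e) (corner S d)\<^esub> (e \<otimes>\<^bsub>S\<^esub> y, d \<otimes>\<^bsub>S\<^esub> y)"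
      using *[OF e'] *[OF d'] by simp
    show "(e \<otimes>\<^bsub>S\<^esub> (x \<oplus>\<^bsub>corner S (e \<oplus>\<^bsub>S\<^esub> d)\<^esub> y), d \<otimes>\<^bsub>S\<^esub> (x \<oplus>\<^bsub>corner S (e \<oplus>\<^bsub>S\<^esub> d)\<^esub> y)) =
      (e \<otimes>\<^bsub>S\<^esub> x, d \<otimes>\<^bsub>S\<^esub> x) \<oplus>\<^bsub>RDirProd (corner S e) (corner S d)\<^esub> (e \<otimes>\<^bsub>S\<^esub> y, d \<otimes>\<^bsub>S\<^esub> y)"
      using e' d' x y by (simp add: r_distr)
  next
    show "(e \<otimes>\<^bsub>S\<^esub> \<one>\<^bsub>corner S (e \<oplus>\<^bsub>S\<^esub> d)\<^esub>, d \<otimes>\<^bsub>S\<^esub> \<one>\<^bsub>corner S (e \<oplus>\<^bsub>S\<^esub> d)\<^esub>) =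
      \<one>\<^bsub>RDirProd (corner S e) (corner S d)\<^esub>"
      using e' d' ed de by (simp add: r_distr)
    show "bij_betw (\<lambda>x. (e \<otimes>\<^bsub>S\<^esub> x, d \<otimes>\<^bsub>S\<^esub> x)) (carrier (corner S (e \<oplus>\<^bsub>S\<^esub> d)))
       (carrier (RDirProd (corner S e) (corner S d)))"
    proof (rule bij_betw_byWitness[where f' = "\<lambda>(x, y). x \<oplus>\<^bsub>S\<^esub> y"])
      show "\<forall>x\<in>carrier (corner S (e \<oplus>\<^bsub>S\<^esub> d)).
          (case (e \<otimes>\<^bsub>S\<^esub> x, d \<otimes>\<^bsub>S\<^esub> x) of (x, y) \<Rightarrow> x \<oplus>\<^bsub>S\<^esub> y) = x"
        using e' d' by (auto simp: mem l_distr simp del: corner_simps(1))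
      have inverse: "e \<otimes>\<^bsub>S\<^esub> (x \<oplus>\<^bsub>S\<^esub> y) = x" "d \<otimes>\<^bsub>S\<^esub> (x \<oplus>\<^bsub>S\<^esub> y) = y"
        "x \<in> carrier S" "y \<in> carrier S"
        if "x \<in> carrier (corner S e)" "y \<in> carrier (corner S d)" for x y
      proof -
        from that have xy: "x \<in> carrier S" "e \<otimes>\<^bsub>S\<^esub> x = x" "y \<in> carrier S" "d \<otimes>\<^bsub>S\<^esub> y = y"
          by (simp_all only: mem)
        then have "d \<otimes>\<^bsub>S\<^esub> x = \<zero>\<^bsub>S\<^esub>" "e \<otimes>\<^bsub>S\<^esub> y = \<zero>\<^bsub>S\<^esub>" using mul by metis+
        with xy e' d' show "e \<otimes>\<^bsub>S\<^esub> (x \<oplus>\<^bsub>S\<^esub> y) = x" "d \<otimes>\<^bsub>S\<^esub> (x \<oplus>\<^bsub>S\<^esub> y) = y"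
          "x \<in> carrier S" "y \<in> carrier S" by (simp_all add: r_distr)
      qed
      show "\<forall>z\<in>carrier (RDirProd (corner S e) (corner S d)).
          (e \<otimes>\<^bsub>S\<^esub> (case z of (x, y) \<Rightarrow> x \<oplus>\<^bsub>S\<^esub> y), d \<otimes>\<^bsub>S\<^esub> (case z of (x, y) \<Rightarrow> x \<oplus>\<^bsub>S\<^esub> y)) = z"
        using inverse by (auto simp del: corner_simps(1))
      show "(\<lambda>x. (e \<otimes>\<^bsub>S\<^esub> x, d \<otimes>\<^bsub>S\<^esub> x)) ` carrier (corner S (e \<oplus>\<^bsub>S\<^esub> d))
          \<subseteq> carrier (RDirProd (corner S e) (corner S d))"
        using mem(3) by auto
      show "(\<lambda>(x, y). x \<oplus>\<^bsub>S\<^esub> y) ` carrier (RDirProd (corner S e) (corner S d))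
          \<subseteq> carrier (corner S (e \<oplus>\<^bsub>S\<^esub> d))"
        using inverse e' d' by (auto simp: mem(3) l_distr simp del: corner_simps(1))
    qed
  qed
qed

lemma corner_one:
  assumes "cring S"
  shows "corner S \<one>\<^bsub>S\<^esub> = S"
proof -
  interpret cring S by fact
  have "(\<lambda>x. \<one>\<^bsub>S\<^esub> \<otimes>\<^bsub>S\<^esub> x) ` carrier S = carrier S" by (auto simp: image_iff)
  then show ?thesis by (simp add: corner_def)
qed

lemma indecomposable_ring_idempotents:
  assumes S: "indecomposable_ring S"
  shows "idempotents S \<subseteq> {\<zero>\<^bsub>S\<^esub>, \<one>\<^bsub>S\<^esub>}"
proof
  fix e assume e: "e \<in> idempotents S"
  have cr: "cring S" using S by (simp add: indecomposable_ring_def)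
  interpret cring S by fact
  have e': "e \<in> carrier S" "e \<otimes>\<^bsub>S\<^esub> e = e" using e by (auto simp: idempotents_def)
  define d where "d = \<one>\<^bsub>S\<^esub> \<ominus>\<^bsub>S\<^esub> e"
  have dc: "d \<in> carrier S" using e' by (simp add: d_def)
  have ed: "e \<otimes>\<^bsub>S\<^esub> d = \<zero>\<^bsub>S\<^esub>"
    using e' by (simp add: d_def minus_eq r_distr r_minus r_neg)
  have sum: "e \<oplus>\<^bsub>S\<^esub> d = \<one>\<^bsub>S\<^esub>"
    using e' unfolding d_def by algebra
  have "d = (e \<oplus>\<^bsub>S\<^esub> d) \<otimes>\<^bsub>S\<^esub> d" using sum dc by simp
  then have "d \<otimes>\<^bsub>S\<^esub> d = d" using ed e' dc by (simp add: l_distr)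
  then have d: "d \<in> idempotents S" using dc by (simp add: idempotents_def)
  have "S \<simeq> RDirProd (corner S e) (corner S d)"
    using corner_add_iso(1)[OF cr e d ed] sum corner_one[OF cr] unfolding is_ring_iso_def by auto
  then have "e = \<zero>\<^bsub>S\<^esub> \<or> d = \<zero>\<^bsub>S\<^esub>"
    using S corner_cring[OF cr e] corner_cring[OF cr d] unfolding indecomposable_ring_def
    by (metis corner_simps(3,4))
  then show "e \<in> {\<zero>\<^bsub>S\<^esub>, \<one>\<^bsub>S\<^esub>}" using sum e' by auto
qed

lemma finite_idempotents_ring_iso:
  assumes h: "h \<in> ring_iso S T" and fin: "finite (idempotents T)"
  shows "finite (idempotents S)"
proof (rule finite_imageD)
  note h = ring_iso_memE[OF h]
  have "h ` idempotents S \<subseteq> idempotents T"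
    using h(1) h(2) unfolding idempotents_def by fastforce
  then show "finite (h ` idempotents S)" using fin finite_subset by blast
  show "inj_on h (idempotents S)"
    using h(5) by (auto simp: bij_betw_def idempotents_def intro: inj_on_subset)
qed

lemma idempotents_RDirProd: "idempotents (RDirProd A B) = idempotents A \<times> idempotents B"
  by (auto simp: idempotents_def)

lemma finite_idempotents_RDirProd_list:
  assumes "\<And>S. S \<in> set Ss \<Longrightarrow> finite (idempotents S)"
  shows "finite (idempotents (RDirProd_list Ss))"
  using assms
proof (induction Ss)
  case Nil
  show ?case by (rule finite_subset[of _ "{[]}"]) (auto simp: idempotents_def)
next
  case (Cons S Ss)
  then have "finite (idempotents (RDirProd S (RDirProd_list Ss)))"
    by (simp add: idempotents_RDirProd)
  then show ?case by (rule finite_idempotents_ring_iso[OF RDirProd_list_iso2])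
qed

lemma ring_of_type_algebra_simps [simp]:
  "carrier ring_of_type_algebra = UNIV"
  "x \<otimes>\<^bsub>ring_of_type_algebra\<^esub> y = x * y" "x \<oplus>\<^bsub>ring_of_type_algebra\<^esub> y = x + y"
  "\<one>\<^bsub>ring_of_type_algebra\<^esub> = 1" "\<zero>\<^bsub>ring_of_type_algebra\<^esub> = (0 :: 'a::comm_ring_1)"
  by (simp_all add: ring_of_type_algebra_def)

lemma idempotents_type: "e \<in> idempotents ring_of_type_algebra \<longleftrightarrow> e * e = (e :: 'a::comm_ring_1)"
  by (simp add: idempotents_def)

text \<open>
  An indecomposable ring has only the idempotents \<open>0\<close> and \<open>1\<close>, and the idempotents of a product are
  the tuples of idempotents.
\<close>

lemma finite_idempotents_type:
  assumes "finite_product_of_indecomposable_rings TYPE('a::comm_ring_1)"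
  shows "finite {e :: 'a. e * e = e}"
proof -
  obtain Ss :: "'a ring list" and h where Ss: "\<forall>S \<in> set Ss. indecomposable_ring S"
    and h: "h \<in> ring_iso (ring_of_type_algebra :: 'a ring) (RDirProd_list Ss)"
    using assms unfolding finite_product_of_indecomposable_rings_def is_ring_iso_def by blast
  have "finite (idempotents (RDirProd_list Ss))"
    using Ss indecomposable_ring_idempotents
    by (intro finite_idempotents_RDirProd_list) (auto intro: finite_subset)
  from finite_idempotents_ring_iso[OF h this] show ?thesis
    by (simp add: idempotents_def)
qed

lemma corner_sum_list_iso:
  fixes es :: "'a::comm_ring_1 list"
  assumes "\<And>e. e \<in> set es \<Longrightarrow> e * e = e" "sorted_wrt (\<lambda>e d. e * d = 0) es"
  shows "(\<exists>h. h \<in> ring_iso (corner ring_of_type_algebra (sum_list es))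
      (RDirProd_list (map (corner ring_of_type_algebra) es))) \<and> sum_list es * sum_list es = sum_list es"
  using assms
proof (induction es)
  case Nil
  have "(\<lambda>_. []) \<in> ring_iso (corner ring_of_type_algebra (0 :: 'a)) nil_ring"
    by (rule ring_iso_memI) (auto simp: bij_betw_def monoid.defs)
  then show ?case by auto
next
  case (Cons e es)
  let ?R = "ring_of_type_algebra :: 'a ring" and ?s = "sum_list es"
  from Cons obtain h where h: "h \<in> ring_iso (corner ?R ?s) (RDirProd_list (map (corner ?R) es))"
    and s: "?s * ?s = ?s" by auto
  have es: "e * ?s = 0"
    using Cons.prems(2) by (induction es) (auto simp: distrib_left)
  have e: "e * e = e" using Cons.prems by simp
  note iso = corner_add_iso[OF cring_from_type_algebra, of e ?s, unfolded idempotents_type, simplified, OF e s es]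
  show ?case
    using ring_iso_set_trans[OF ring_iso_set_trans[OF iso(1) RDirProd_iso5[OF h]] RDirProd_list_iso1] iso(2)
    by auto
qed

text \<open>
  A decomposition of the corner ring would yield, as preimage of \<open>(1, 0)\<close>, an idempotent strictly
  between \<open>0\<close> and \<open>e\<close>.
\<close>

lemma corner_primitive_indecomposable:
  fixes e :: "'a::comm_ring_1"
  assumes "primitive_idempotent e"
  shows "indecomposable_ring (corner ring_of_type_algebra e)"
proof -
  let ?C = "corner ring_of_type_algebra e"
  have ee: "e * e = e" and e0: "e \<noteq> 0"
    and prim: "\<And>d. d * d = d \<Longrightarrow> d * e = d \<Longrightarrow> d = 0 \<or> d = e"
    using assms by (auto simp: primitive_idempotent_def)
  have e: "e \<in> idempotents ring_of_type_algebra" using ee by (simp add: idempotents_type)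
  have C: "cring ?C" using corner_cring[OF cring_from_type_algebra e] .
  have False if A: "cring A" "\<one>\<^bsub>A\<^esub> \<noteq> \<zero>\<^bsub>A\<^esub>" and B: "cring B" "\<one>\<^bsub>B\<^esub> \<noteq> \<zero>\<^bsub>B\<^esub>"
    and iso: "?C \<simeq> RDirProd A B" for A B :: "'a ring"
  proof -
    obtain h where h: "h \<in> ring_iso ?C (RDirProd A B)" using iso by (auto simp: is_ring_iso_def)
    note hE = ring_iso_memE[OF h]
    interpret A: cring A by fact
    interpret B: cring B by fact
    have "(\<one>\<^bsub>A\<^esub>, \<zero>\<^bsub>B\<^esub>) \<in> carrier (RDirProd A B)" by simp
    then obtain d where d: "d \<in> carrier ?C" "h d = (\<one>\<^bsub>A\<^esub>, \<zero>\<^bsub>B\<^esub>)"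
      using hE(5) unfolding bij_betw_def by (metis imageE)
    have "h (d * d) = h d" using hE(2)[OF d(1,1)] d(2) by simp
    moreover have "d * d \<in> carrier ?C"
      using monoid.m_closed[OF ring.is_monoid[OF cring.axioms(1)[OF C]] d(1,1)] by simp
    ultimately have "d * d = d"
      using hE(5) d(1) unfolding bij_betw_def by (meson inj_onD)
    moreover have "d * e = d"
      using d(1) corner_mem[OF cring_from_type_algebra e] by (simp add: mult.commute del: corner_simps(1))
    ultimately consider "d = 0" | "d = e" using prim by blast
    then show False
    proof cases
      case 1
      have "h \<zero>\<^bsub>?C\<^esub> = \<zero>\<^bsub>RDirProd A B\<^esub>"
        using h C A(1) B(1) unfolding ring_iso_def
        by (intro ring_hom_zero) (auto intro: cring.axioms(1) RDirProd_ring)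
      with 1 d A(2) show False by simp
    next
      case 2
      have "h e = (\<one>\<^bsub>A\<^esub>, \<one>\<^bsub>B\<^esub>)" using hE(4) by simp
      with 2 d B(2) show False by simp
    qed
  qed
  then show ?thesis
    using C e0 unfolding indecomposable_ring_def by auto
qed

lemma finite_product_of_indecomposable_ringsI:
  fixes E :: "'a::comm_ring_1 set"
  assumes E: "orthogonal_idempotents E" and prim: "\<And>e. e \<in> E \<Longrightarrow> primitive_idempotent e"
  shows "finite_product_of_indecomposable_rings TYPE('a)"
proof -
  obtain es where es: "set es = E" "distinct es"
    using E finite_distinct_list[of E] unfolding orthogonal_idempotents_def by blast
  let ?R = "ring_of_type_algebra :: 'a ring"
  have sum: "sum_list es = 1"
    using es E by (simp add: orthogonal_idempotents_def distinct_sum_list_conv_Sum)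
  have "sorted_wrt (\<lambda>e d. e * d = 0) es"
    using es E by (auto simp: orthogonal_idempotents_def sorted_wrt_iff_nth_less distinct_conv_nth)
  then have "?R \<simeq> RDirProd_list (map (corner ?R) es)"
    using corner_sum_list_iso[of es] es E sum corner_one[OF cring_from_type_algebra, where ?'a1 = 'a]
    by (auto simp: is_ring_iso_def orthogonal_idempotents_def)
  moreover have "\<forall>S \<in> set (map (corner ?R) es). indecomposable_ring S"
    using corner_primitive_indecomposable es prim by auto
  moreover have "es \<noteq> []" using sum by auto
  ultimately show ?thesis
    unfolding finite_product_of_indecomposable_rings_def by (metis map_is_Nil_conv)
qed

lemma finite_product_of_indecomposable_ringsE:
  assumes "finite_product_of_indecomposable_rings TYPE('a::comm_ring_1)"
  obtains E :: "'a::comm_ring_1 set" where "orthogonal_idempotents E" "\<And>e. e \<in> E \<Longrightarrow> primitive_idempotent e"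
proof -
  have "card E \<le> card {e :: 'a. e * e = e}" if "orthogonal_idempotents E" for E :: "'a set"
    using that finite_idempotents_type[OF assms]
    by (intro card_mono) (auto simp: orthogonal_idempotents_def)
  then show ?thesis
    using orthogonal_primitive_idempotents_exist that by blast
qed

section \<open>Divisors of powers of the indeterminate\<close>

lemma poly_X_power: "poly_X ^ n = monom (1 :: 'a::comm_ring_1) n"
  by (simp only: monom_altdef smult_1_left)

lemma poly_X_power_regular:
  assumes "f dvd poly_X ^ n" "f * y = (0 :: 'a::comm_ring_1 poly)"
  shows "y = 0"
proof -
  from assms(1) obtain h where "poly_X ^ n = f * h" ..
  then have "poly_X ^ n * y = h * (f * y)"
    by (simp only: ac_simps)
  then have "poly_X ^ n * y = 0"
    using assms(2) by simp
  then have "coeff (monom 1 n * y) (n + k) = 0" for k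
    by (simp add: poly_X_power)
  then show ?thesis
    by (simp add: coeff_monom_mult poly_eq_iff)
qed

lemma const_dvd_poly_X_power:
  assumes "[:a:] dvd poly_X ^ n"
  shows "[:a:] dvd (1 :: 'a::comm_ring_1 poly)"
proof -
  from assms obtain h where "monom 1 n = smult a h"
    by (auto simp: poly_X_power dvd_def)
  then have "1 = a * coeff h n"
    by (metis coeff_monom coeff_smult)
  then have "1 = [:a:] * [:coeff h n:]"
    by (simp add: one_pCons mult.commute)
  then show ?thesis
    by (rule dvdI)
qed

text \<open>
  The library's \<^const>\<open>Factorial_Ring.irreducible\<close> demands that one factor of every factorization
  be a unit. In general it is stronger than being an atom or a nonunit indecomposable polynomial;
  for divisors of a power of \<open>X\<close> all three notions agree. For atoms this is because such divisors
  are regular, and for indecomposable polynomials because a constant that divides a power of \<open>X\<close>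
  is a unit.
\<close>

lemma irreducible_imp_atom:
  assumes "irreducible f"
  shows "is_atom f"
proof -
  have "associates (u * c) c" if "u dvd 1" for u c :: 'a
  proof -
    from that obtain v where v: "1 = u * v" by (auto simp: dvd_def)
    have "r * c = (r * v) * (u * c)" for r
      using v by (metis mult.assoc mult.commute mult_1)
    moreover have "r * (u * c) = (r * u) * c" for r by (simp add: mult.assoc)
    ultimately show ?thesis unfolding associates_def by blast
  qed
  with assms show ?thesis
    unfolding is_atom_def associates_def by (metis irreducible_def mult.commute)
qed

lemma strong_associates_one: "f dvd 1 \<Longrightarrow> strong_associates f 1"
  by (auto simp: strong_associates_def)

lemma irreducible_imp_indecomposable_poly:
  assumes "irreducible f"
  shows "indecomposable_poly f"
  unfolding indecomposable_poly_def
proof (intro allI impI exI[of _ 1])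
  fix g h assume "f = g * h"
  with assms have "g dvd 1 \<or> h dvd 1" by (rule irreducibleD)
  then show "strong_associates g [:1:] \<or> strong_associates h [:1:]"
    using strong_associates_one by (auto simp flip: one_pCons)
qed

lemma associates_imp_dvd:
  assumes "associates a b"
  shows "a dvd b"
proof -
  have "1 * b \<in> range (\<lambda>r. r * a)"
    using assms unfolding associates_def by blast
  then show ?thesis by auto
qed

lemma atom_imp_irreducible:
  assumes "f dvd poly_X ^ n" "is_atom f"
  shows "irreducible f"
proof (rule irreducibleI)
  have unit: "h dvd 1" if "f = g * h" "associates f g" for g h
  proof -
    from associates_imp_dvd[OF that(2)] obtain s where s: "g = f * s" ..
    then have "f * (s * h) = f" using that(1) by (metis mult.assoc)
    then have "f * (1 - s * h) = 0" by (simp add: right_diff_distrib)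
    with assms(1) have "1 - s * h = 0" using poly_X_power_regular by blast
    then have "1 = h * s" by (simp add: mult.commute)
    then show ?thesis by (rule dvdI)
  qed
  show "f \<noteq> 0"
    using poly_X_power_regular[OF assms(1), of 1] by auto
  show "\<not> f dvd 1" using assms(2) by (simp add: is_atom_def)
  show "g dvd 1 \<or> h dvd 1" if "f = g * h" for g h
  proof -
    have "associates f g \<or> associates f h"
      using assms(2) that unfolding is_atom_def by blast
    then show ?thesis
      using unit[of g h] unit[of h g] that by (auto simp: mult.commute)
  qed
qed

lemma indecomposable_poly_imp_irreducible:
  assumes "f dvd poly_X ^ n" "indecomposable_poly f" "\<not> f dvd 1"
  shows "irreducible f"
proof (rule irreducibleI)
  have unit: "g dvd 1" if "g dvd f" "strong_associates g [:a:]" for g a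
  proof -
    from that(2) obtain u where u: "u dvd 1" "g = u * [:a:]"
      unfolding strong_associates_def by blast
    then have "[:a:] dvd f" using that(1) dvd_mult_right by blast
    then have "[:a:] dvd 1" using assms(1) const_dvd_poly_X_power dvd_trans by blast
    with u show ?thesis by (simp only: mult_dvd_1_iff)
  qed
  show "f \<noteq> 0"
    using poly_X_power_regular[OF assms(1), of 1] by auto
  show "\<not> f dvd 1" by fact
  show "g dvd 1 \<or> h dvd 1" if "f = g * h" for g h
  proof -
    obtain a where "strong_associates g [:a:] \<or> strong_associates h [:a:]"
      using assms(2) \<open>f = g * h\<close> unfolding indecomposable_poly_def by blast
    then show ?thesis using unit \<open>f = g * h\<close> by auto
  qed
qed

section \<open>Factorizations of the indeterminate\<close>

text \<open>
  The heart of the matter. In the factor of \<open>e\<close>, suppose \<open>X = g h\<close>. Comparing coefficients,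
  \<open>g\<^sub>0 h\<^sub>0 = 0\<close> and \<open>g\<^sub>0 h\<^sub>1 + g\<^sub>1 h\<^sub>0 = 1\<close>, so the two summands are orthogonal idempotents there and, by
  primitivity, one of them is \<open>1\<close>. If it is \<open>g\<^sub>0 h\<^sub>1\<close>, then \<open>h\<^sub>0 = 0\<close>, so \<open>h = X h'\<close>, and
  cancelling \<open>X\<close> gives \<open>g h' = 1\<close>. In the factor of \<open>1 - e\<close> both \<open>g\<close> and \<open>h\<close> are units, since
  their product is \<open>1\<close>.
\<close>

lemma poly_X_on_primitive_irreducible:
  fixes e :: "'a::comm_ring_1"
  assumes "primitive_idempotent e"
  shows "irreducible (on_part [:e:] poly_X)"
proof (rule irreducibleI)
  from assms have ee: "e * e = e" and e0: "e \<noteq> 0"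
    and prim: "\<And>d. d * d = d \<Longrightarrow> d * e = d \<Longrightarrow> d = 0 \<or> d = e"
    by (auto simp: primitive_idempotent_def)
  let ?e = "[:e:]" and ?X = "on_part [:e:] poly_X"
  have EE: "?e * ?e = ?e" by (simp add: ee)
  have X: "?X = [:1 - e, e:]"
    by (simp add: on_part_def one_pCons)
  show "?X \<noteq> 0" using e0 X by simp
  show "\<not> ?X dvd 1"
  proof
    assume "?X dvd 1"
    then obtain k where "1 = [:1 - e, e:] * k" by (auto simp: X dvd_def)
    from arg_cong[OF this, of "\<lambda>p. coeff p 0"] have "1 = (1 - e) * coeff k 0"
      by (simp add: coeff_mult)
    then have "e = e * (1 - e) * coeff k 0"
      by (metis mult.assoc mult.right_neutral)
    then show False using ee e0 by (simp add: algebra_simps)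
  qed
  have key: "g dvd 1" if gh: "?X = g * h" and one: "e * (coeff g 0 * coeff h 1) = e" for g h
  proof -
    have "coeff g 0 * coeff h 0 = 1 - e"
      using arg_cong[OF gh, of "\<lambda>p. coeff p 0"] X by (simp add: coeff_mult)
    then have "e * (1 - e) * coeff h 1 = e * (coeff g 0 * coeff h 1) * coeff h 0"
      using \<open>coeff g 0 * coeff h 0 = 1 - e\<close>[symmetric] by (simp add: ac_simps)
    then have h0: "e * coeff h 0 = 0"
      unfolding one by (simp add: right_diff_distrib ee)
    obtain h0' h' where h: "h = pCons h0' h'" by (cases h)
    have "?e * h = poly_X * (?e * h')" using h h0 by (simp add: mult.commute)
    moreover have "?e * (g * h) = poly_X * ?e" using gh[symmetric] X ee by (simp add: algebra_simps)
    ultimately have "poly_X * (?e * (g * h') - ?e) = 0"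
      by (simp only: right_diff_distrib) (metis mult.left_commute diff_self)
    then have eg: "?e * (g * h') = ?e"
      using poly_X_power_regular[of poly_X 1] by simp
    then have "on_part ?e (g * h') = 1" by (simp add: on_part_def)
    then have "on_part ?e g dvd 1" using on_part_mult[OF EE] by (metis dvdI)
    moreover have "on_part (1 - ?e) g dvd 1"
    proof -
      have "(1 - ?e) * (1 - ?e) = 1 - ?e" using EE by (rule idempotent_compl)
      moreover have "on_part (1 - ?e) ?X = 1"
        using EE by (simp only: on_part_on_part) (simp add: algebra_simps)
      ultimately show ?thesis using gh on_part_mult by (metis dvdI)
    qed
    ultimately show ?thesis using on_part_split[OF EE] by (metis mult_dvd_1_iff)
  qed
  show "g dvd 1 \<or> h dvd 1" if gh: "?X = g * h" for g h
  proof -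
    let ?a = "e * (coeff g 0 * coeff h 1)" and ?b = "e * (coeff h 0 * coeff g 1)"
    have c0: "coeff g 0 * coeff h 0 = 1 - e"
      using arg_cong[OF gh, of "\<lambda>p. coeff p 0"] X by (simp add: coeff_mult)
    have c1: "coeff g 0 * coeff h 1 + coeff g 1 * coeff h 0 = e"
      using arg_cong[OF gh, of "\<lambda>p. coeff p 1"] X by (simp add: coeff_mult)
    have ab: "?a + ?b = e"
      using arg_cong[OF c1, of "\<lambda>x. e * x"] ee by (simp add: distrib_left ac_simps)
    have "?a * ?b = e * (e * (coeff g 0 * coeff h 0)) * (coeff h 1 * coeff g 1)"
      by (simp only: ac_simps)
    then have "?a * ?b = 0"
      using ee by (simp add: c0 idempotent_left algebra_simps)
    moreover have ae: "?a * e = ?a"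
      using ee by (simp add: ac_simps idempotent_left)
    ultimately have "?a * ?a = ?a"
      using ab by (metis add.right_neutral distrib_left)
    with prim[OF _ ae] ab have "?a = e \<or> ?b = e" by auto
    then show ?thesis using key[of g h] key[of h g] gh by (auto simp: mult.commute)
  qed
qed

lemma on_part_const_sum:
  fixes J :: "'a::comm_ring_1 set"
  assumes "finite J" "\<And>e d. e \<in> J \<Longrightarrow> d \<in> J \<Longrightarrow> e \<noteq> d \<Longrightarrow> e * d = 0"
  shows "on_part [:\<Sum>J:] f = (\<Prod>e\<in>J. on_part [:e:] f)"
  using assms
proof (induction J rule: finite_induct)
  case (insert j J)
  have "j * \<Sum>J = 0" using insert by (intro sum_orthogonal_left) auto
  then have "[:j:] * [:\<Sum>J:] = 0" by (simp add: mult.commute)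
  from on_part_add[OF this] insert show ?case by simp
qed simp

lemma poly_X_factorization:
  fixes E :: "'a::comm_ring_1 set"
  assumes "orthogonal_idempotents E"
  shows "poly_X = (\<Prod>e\<in>E. on_part [:e:] poly_X)"
proof -
  have "[:\<Sum>E:] = 1"
    using assms by (simp add: orthogonal_idempotents_def one_pCons)
  moreover have "on_part [:\<Sum>E:] poly_X = (\<Prod>e\<in>E. on_part [:e:] poly_X)"
    using assms by (intro on_part_const_sum) (auto simp: orthogonal_idempotents_def)
  ultimately show ?thesis
    by (metis on_part_one_left)
qed

text \<open>
  For each \<open>e\<close> in the system, some factor of \<open>X\<^sup>n\<close> is a nonunit at \<open>e\<close>, because \<open>X\<^sup>n\<close> is. An
  irreducible factor is a nonunit at one member of the system only, being the product of its parts at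
  \<open>e\<close> and \<open>1 - e\<close>. Hence distinct members use distinct factors.
\<close>

lemma card_orthogonal_idempotents_le:
  fixes E :: "'a::comm_ring_1 set"
  assumes E: "orthogonal_idempotents E" and n: "n \<ge> 1"
    and F: "poly_X ^ n = prod_mset F" "\<And>f :: 'a poly. f \<in># F \<Longrightarrow> f dvd 1 \<or> irreducible f"
  shows "card E \<le> size F"
proof -
  have idem: "[:e:] * [:e:] = [:e:]" if "e \<in> E" for e
    using E that by (simp add: orthogonal_idempotents_def)
  have "\<exists>f. f \<in># F \<and> \<not> on_part [:e:] f dvd 1" if e: "e \<in> E" for e
  proof (rule ccontr)
    assume "\<nexists>f. f \<in># F \<and> \<not> on_part [:e:] f dvd 1"
    then have "on_part [:e:] (poly_X ^ n) dvd 1"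
      unfolding F(1) on_part_prod_mset[OF idem[OF e]] by (intro prod_mset_dvd_1) auto
    then obtain k where "1 = on_part [:e:] (poly_X ^ n) * k" ..
    \<comment> \<open>The constant coefficient of the part at \<open>e\<close> is \<open>1 - e\<close>, which \<open>e\<close> annihilates.\<close>
    from arg_cong[OF this, of "\<lambda>p. coeff p 0"]
    have "1 = coeff (on_part [:e:] (poly_X ^ n)) 0 * coeff k 0"
      by (simp add: coeff_mult)
    moreover have "coeff (on_part [:e:] (poly_X ^ n)) 0 = 1 - e"
      using n by (simp add: on_part_def poly_X_power)
    ultimately have "e = e * (1 - e) * coeff k 0"
      by (simp add: mult.assoc)
    moreover have "e * e = e" "e \<noteq> 0" using E e by (auto simp: orthogonal_idempotents_def)
    ultimately show False by (simp add: algebra_simps)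
  qed
  then obtain c where c: "\<And>e. e \<in> E \<Longrightarrow> c e \<in># F \<and> \<not> on_part [:e:] (c e) dvd 1"
    by metis
  have "inj_on c E"
  proof (rule inj_onI, rule ccontr)
    fix e d assume ed: "e \<in> E" "d \<in> E" "c e = c d" "e \<noteq> d"
    have "irreducible (c e)"
      using c[OF ed(1)] F(2) on_part_dvd_1 idem ed by blast
    then have "on_part (1 - [:e:]) (c e) dvd 1"
      using irreducible_on_part idem c ed by blast
    then have "on_part [:d:] (on_part (1 - [:e:]) (c e)) dvd 1"
      by (rule on_part_dvd_1[OF idem[OF ed(2)]])
    moreover have "[:d:] * (1 - [:e:]) = [:d:]"
      using E ed by (simp add: orthogonal_idempotents_def algebra_simps)
    ultimately show False using c ed by (simp add: on_part_on_part)
  qed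
  then have "card E \<le> card (set_mset F)"
    using c by (intro card_inj_on_le[where f = c]) auto
  also have "\<dots> \<le> size F"
    by (metis mset_set_set_mset_msubset size_mset_mono size_mset_set)
  finally show ?thesis .
qed

text \<open>
  Uniqueness is proved by splitting off one idempotent at a time: an irreducible factor that is a
  nonunit at \<open>j\<close> is a unit multiple of the part of \<open>X\<close> at \<open>j\<close>, which can then be cancelled. The
  unit \<open>u\<close> absorbs the units that arise in the process.
\<close>

lemma irreducible_factorization_unique_aux:
  fixes J :: "'a::comm_ring_1 set"
  assumes "finite J" "\<And>e. e \<in> J \<Longrightarrow> primitive_idempotent e"
    "\<And>e d. e \<in> J \<Longrightarrow> d \<in> J \<Longrightarrow> e \<noteq> d \<Longrightarrow> e * d = 0"
    "\<And>f. f \<in># F \<Longrightarrow> irreducible f" "u dvd 1" "prod_mset F = u * on_part [:\<Sum>J:] poly_X"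
  shows "rel_mset strong_associates F (image_mset (\<lambda>e. on_part [:e:] poly_X) (mset_set J))"
  using assms
proof (induction J arbitrary: F u rule: finite_induct)
  case empty
  have "F = {#}"
  proof (rule ccontr)
    assume "F \<noteq> {#}"
    then obtain f where f: "f \<in># F" by blast
    then have "f dvd 1" using dvd_prod_mset[OF f] empty by (auto intro: dvd_trans)
    with empty f show False by (meson irreducible_not_unit)
  qed
  then show ?case by (simp add: rel_mset_Zero)
next
  case (insert j J)
  let ?p = "on_part [:j:] poly_X" and ?q = "on_part [:\<Sum>J:] poly_X"
  have jj: "[:j:] * [:j:] = [:j:]"
    using insert.prems(1)[of j] by (simp add: primitive_idempotent_def)
  have "j * \<Sum>J = 0"
    using insert.hyps insert.prems(2)[of j] by (intro sum_orthogonal_left) auto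
  then have jJ: "[:j:] * [:\<Sum>J:] = 0" by (simp add: mult.commute)
  have F: "prod_mset F = u * (?p * ?q)"
    using insert.prems(5) insert.hyps on_part_add[OF jJ] by simp
  have p: "irreducible ?p"
    using insert.prems(1) by (intro poly_X_on_primitive_irreducible) simp
  have p_idem: "on_part [:j:] ?p = ?p" by (simp only: on_part_on_part jj)
  have "\<exists>f. f \<in># F \<and> \<not> on_part [:j:] f dvd 1"
  proof (rule ccontr)
    assume "\<nexists>f. f \<in># F \<and> \<not> on_part [:j:] f dvd 1"
    then have "on_part [:j:] (prod_mset F) dvd 1"
      unfolding on_part_prod_mset[OF jj] by (intro prod_mset_dvd_1) auto
    moreover have "?p dvd prod_mset F" using F by simp
    then have "?p dvd on_part [:j:] (prod_mset F)"
      using on_part_dvd[OF jj] p_idem by metis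
    ultimately show False using p irreducible_not_unit dvd_trans by blast
  qed
  then obtain f where f: "f \<in># F" "\<not> on_part [:j:] f dvd 1" by blast
  then obtain F' where F': "F = add_mset f F'" by (meson multi_member_split)
  have f_irr: "irreducible f" using f insert.prems by blast
  have unit1: "on_part (1 - [:j:]) f dvd 1"
    using irreducible_on_part[OF f_irr jj f(2)] .
  have "on_part [:j:] f * on_part [:j:] (prod_mset F')
      = on_part [:j:] u * (?p * on_part [:j:] ?q)"
    using F F' by (metis on_part_mult[OF jj] p_idem prod_mset.add_mset)
  then have "on_part [:j:] f * on_part [:j:] (prod_mset F') = on_part [:j:] u * ?p"
    by (simp only: on_part_on_part jJ) simp
  moreover obtain u' where u': "1 = on_part [:j:] u * u'"
    using on_part_dvd_1[OF jj insert.prems(4)] by (auto simp: dvd_def)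
  ultimately have "?p = u' * (on_part [:j:] f * on_part [:j:] (prod_mset F'))"
    using unit_cancel_left[of "on_part [:j:] u" u' ?p] by simp
  then have pf: "?p = on_part [:j:] f * (on_part [:j:] (prod_mset F') * u')"
    by (simp only: ac_simps)
  with p f(2) have "on_part [:j:] (prod_mset F') * u' dvd 1"
    using irreducibleD by blast
  \<comment> \<open>At \<open>j\<close>, the factor \<open>f\<close> and \<open>X\<close> differ by the unit \<open>w\<close>; away from \<open>j\<close>, \<open>f\<close> is a unit.\<close>
  then obtain w where w: "1 = (on_part [:j:] (prod_mset F') * u') * w" ..
  then have "on_part [:j:] f = w * ?p"
    using pf unit_cancel_left[OF w[symmetric], of "on_part [:j:] f"] by (simp only: ac_simps)
  then have "f = (w * on_part (1 - [:j:]) f) * ?p"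
    using on_part_split[OF jj, of f] by (simp only: ac_simps)
  moreover have "w * on_part (1 - [:j:]) f dvd 1"
    using unit1 w by (metis dvd_triv_right mult_dvd_1_iff)
  ultimately obtain v where v: "v dvd 1" "f = v * ?p" by blast
  obtain v' where v': "1 = v * v'" using v by (auto simp: dvd_def)
  have "?p * prod_mset F' = v' * (f * prod_mset F')"
    using unit_cancel_left[OF v'[symmetric]] by (simp only: v(2) mult.assoc)
  also have "f * prod_mset F' = u * (?p * ?q)" using F F' by simp
  finally have "?p * (prod_mset F' - v' * u * ?q) = 0"
    by (simp add: right_diff_distrib ac_simps)
  moreover have "?p dvd poly_X ^ 1"
    using on_part_split[OF jj, of poly_X] by (metis dvdI power_one_right)
  ultimately have "prod_mset F' - v' * u * ?q = 0"
    using poly_X_power_regular by blast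
  then have "prod_mset F' = (v' * u) * ?q" by simp
  moreover have "v' dvd 1" using v' by (metis dvd_triv_right)
  then have "v' * u dvd 1" using insert.prems(4) mult_dvd_1_iff by blast
  ultimately have "rel_mset strong_associates F' (image_mset (\<lambda>e. on_part [:e:] poly_X) (mset_set J))"
    using insert.prems F' by (intro insert.IH[of F' "v' * u"]) auto
  moreover have "strong_associates f ?p" using v by (auto simp: strong_associates_def)
  ultimately show ?case
    using insert.hyps F' by (simp add: rel_mset_Plus)
qed

lemma irreducible_factorization_poly_X_unique:
  fixes F G :: "'a::comm_ring_1 poly multiset"
  assumes E: "orthogonal_idempotents (E :: 'a set)" "\<forall>e\<in>E. primitive_idempotent e"
    and F: "\<And>f. f \<in># F \<Longrightarrow> irreducible f" "poly_X = prod_mset F"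
    and G: "\<And>g. g \<in># G \<Longrightarrow> irreducible g" "poly_X = prod_mset G"
  shows "rel_mset strong_associates F G"
proof -
  let ?M = "image_mset (\<lambda>e. on_part [:e:] poly_X) (mset_set E)"
  have *: "rel_mset strong_associates H ?M"
    if "\<And>f. f \<in># H \<Longrightarrow> irreducible f" "poly_X = prod_mset H" for H
    using that E
    by (intro irreducible_factorization_unique_aux[where u = 1])
      (auto simp: orthogonal_idempotents_def simp flip: one_pCons)
  have "rel_mset (strong_associates\<inverse>\<inverse>) ?M G"
    using *[OF G] by (simp add: multiset.rel_flip)
  with *[OF F] have "rel_mset (strong_associates OO strong_associates\<inverse>\<inverse>) F G"
    by (auto simp: multiset.rel_compp)
  moreover have "strong_associates f g" if "(strong_associates OO strong_associates\<inverse>\<inverse>) f g"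
    for f g :: "'a poly"
  proof -
    from that obtain h u v where "u dvd 1" "f = u * h" "v dvd 1" "g = v * h"
      by (auto simp: strong_associates_def)
    moreover from this obtain w where w: "1 = v * w" by (auto simp: dvd_def)
    moreover have "w dvd 1" using w by (metis dvd_triv_right)
    ultimately have "f = (u * w) * g" "u * w dvd 1"
      by (metis mult.assoc mult.commute mult.right_neutral, simp add: mult_dvd_1_iff)
    then show ?thesis by (auto simp: strong_associates_def)
  qed
  ultimately show ?thesis by (rule multiset.rel_mono_strong)
qed

section \<open>The equivalences\<close>

lemma finite_product_of_mult:
  assumes "finite_product_of P x" "finite_product_of P y"
  shows "finite_product_of P (x * y)"
proof -
  from assms obtain F G where "\<forall>f \<in># F. P f" "x = prod_mset F" "\<forall>g \<in># G. P g" "y = prod_mset G"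
    unfolding finite_product_of_def by blast
  then show ?thesis
    unfolding finite_product_of_def by (intro exI[of _ "F + G"]) auto
qed

lemma finite_product_of_power:
  assumes "finite_product_of P x"
  shows "finite_product_of P (x ^ n)"
proof (induction n)
  case 0
  show ?case unfolding finite_product_of_def by (rule exI[of _ "{#}"]) simp
qed (simp add: assms finite_product_of_mult)

lemma finite_product_of_poly_X:
  assumes "finite_product_of_indecomposable_rings TYPE('a::comm_ring_1)"
    and P: "\<And>f :: 'a poly. irreducible f \<Longrightarrow> P f"
  shows "finite_product_of P (poly_X :: 'a poly)"
proof -
  obtain E :: "'a set" where E: "orthogonal_idempotents E" "\<And>e. e \<in> E \<Longrightarrow> primitive_idempotent e"
    using finite_product_of_indecomposable_ringsE[OF assms(1)] by metis
  let ?F = "image_mset (\<lambda>e. on_part [:e:] poly_X) (mset_set E)"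
  have "finite E" using E(1) by (simp add: orthogonal_idempotents_def)
  then have "\<forall>f \<in># ?F. P f"
    using E(2) P poly_X_on_primitive_irreducible by auto
  moreover have "poly_X = prod_mset ?F"
    using poly_X_factorization[OF E(1)] by (simp add: prod_unfold_prod_mset)
  ultimately show ?thesis unfolding finite_product_of_def by blast
qed

lemma finite_product_of_indecomposable_rings_if_poly_X_power:
  assumes "n \<ge> 1" "finite_product_of P (poly_X ^ n :: 'a::comm_ring_1 poly)"
    and P: "\<And>f. f dvd poly_X ^ n \<Longrightarrow> P f \<Longrightarrow> f dvd 1 \<or> irreducible f"
  shows "finite_product_of_indecomposable_rings TYPE('a)"
proof -
  obtain F where F: "\<forall>f \<in># F. P f" "poly_X ^ n = prod_mset F"
    using assms(2) unfolding finite_product_of_def by blast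
  have unit_or_irreducible: "f dvd 1 \<or> irreducible f" if "f \<in># F" for f
    using that F by (intro P) (auto intro: dvd_prod_mset)
  have "card E \<le> size F" if "orthogonal_idempotents E" for E :: "'a set"
    using card_orthogonal_idempotents_le[OF that assms(1) F(2) unit_or_irreducible] .
  then show ?thesis
    using orthogonal_primitive_idempotents_exist finite_product_of_indecomposable_ringsI by blast
qed

lemma poly_X_finite_product_equivalences:
  fixes P :: "'a::comm_ring_1 poly \<Rightarrow> bool"
  assumes P1: "\<And>f. irreducible f \<Longrightarrow> P f"
    and P2: "\<And>f n. f dvd poly_X ^ n \<Longrightarrow> P f \<Longrightarrow> f dvd 1 \<or> irreducible f"
  shows "(finite_product_of_indecomposable_rings TYPE('a) \<longleftrightarrow> finite_product_of P poly_X) \<and>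
    (finite_product_of_indecomposable_rings TYPE('a) \<longleftrightarrow>
      (\<forall>n\<ge>1. finite_product_of P (poly_X ^ n))) \<and>
    (finite_product_of_indecomposable_rings TYPE('a) \<longleftrightarrow>
      (\<exists>n\<ge>1. finite_product_of P (poly_X ^ n)))"
proof -
  have "finite_product_of P poly_X" if "finite_product_of_indecomposable_rings TYPE('a)"
    using finite_product_of_poly_X[OF that P1] .
  moreover have "\<forall>n\<ge>1. finite_product_of P (poly_X ^ n)" if "finite_product_of P poly_X"
    using finite_product_of_power[OF that] by blast
  moreover have "finite_product_of P poly_X" "\<exists>n\<ge>1. finite_product_of P (poly_X ^ n)"
    if "\<forall>n\<ge>1. finite_product_of P (poly_X ^ n)"
    using that[rule_format, of 1] that by auto
  moreover have "finite_product_of_indecomposable_rings TYPE('a)"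
    if "\<exists>n\<ge>1. finite_product_of P (poly_X ^ n)"
    using that finite_product_of_indecomposable_rings_if_poly_X_power P2 by blast
  ultimately show ?thesis by blast
qed

lemma unique_finite_product_of_poly_X:
  fixes P :: "'a::comm_ring_1 poly \<Rightarrow> bool"
  assumes fin: "finite_product_of_indecomposable_rings TYPE('a)"
    and P1: "\<And>f. irreducible f \<Longrightarrow> P f" and P2: "\<And>f. f dvd poly_X \<Longrightarrow> P f \<Longrightarrow> irreducible f"
  shows "unique_finite_product_of P poly_X"
proof -
  obtain E :: "'a set" where E: "orthogonal_idempotents E" "\<And>e. e \<in> E \<Longrightarrow> primitive_idempotent e"
    using finite_product_of_indecomposable_ringsE[OF fin] by metis
  have irr: "irreducible f" if "\<forall>f \<in># F. P f" "poly_X = prod_mset F" "f \<in># F" for f F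
    using that by (intro P2) (auto intro: dvd_prod_mset)
  show ?thesis
    unfolding unique_finite_product_of_def
  proof (intro conjI allI impI)
    show "finite_product_of P poly_X" using finite_product_of_poly_X[OF fin P1] .
    fix F G :: "'a poly multiset"
    assume "(\<forall>f \<in># F. P f) \<and> poly_X = prod_mset F \<and> (\<forall>g \<in># G. P g) \<and> poly_X = prod_mset G"
    then show "rel_mset strong_associates F G"
      using irr[of F] irr[of G] E by (intro irreducible_factorization_poly_X_unique) blast+
  qed
qed

theorem theorem4p3:
  shows
    "(\<forall>P \<in> {is_atom, indecomposable_poly :: 'a::comm_ring_1 poly \<Rightarrow> bool}.
        (finite_product_of_indecomposable_rings TYPE('a) \<longleftrightarrow> finite_product_of P poly_X) \<and>
        (finite_product_of_indecomposable_rings TYPE('a) \<longleftrightarrow> (\<forall>n\<ge>1. finite_product_of P (poly_X ^ n))) \<and>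
        (finite_product_of_indecomposable_rings TYPE('a) \<longleftrightarrow> (\<exists>n\<ge>1. finite_product_of P (poly_X ^ n)))) \<and>
     (finite_product_of_indecomposable_rings TYPE('a) \<longrightarrow>
        unique_finite_product_of is_atom (poly_X :: 'a poly) \<and>
        unique_finite_product_of (\<lambda>f. \<not> f dvd 1 \<and> indecomposable_poly f) (poly_X :: 'a poly))"
proof -
  have unique: "f dvd poly_X \<Longrightarrow> is_atom f \<Longrightarrow> irreducible f"
      "f dvd poly_X \<Longrightarrow> \<not> f dvd 1 \<and> indecomposable_poly f \<Longrightarrow> irreducible f" for f :: "'a poly"
    using atom_imp_irreducible[of f 1] indecomposable_poly_imp_irreducible[of f 1] by auto
  have nonunit_indecomposable: "\<not> f dvd 1 \<and> indecomposable_poly f"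
    if "irreducible f" for f :: "'a poly"
    using that irreducible_imp_indecomposable_poly irreducible_not_unit by blast
  show ?thesis
  proof (intro conjI[of "\<forall>P\<in>_. _ P"] impI)
    show "\<forall>P \<in> {is_atom, indecomposable_poly :: 'a poly \<Rightarrow> bool}.
        (finite_product_of_indecomposable_rings TYPE('a) \<longleftrightarrow> finite_product_of P poly_X) \<and>
        (finite_product_of_indecomposable_rings TYPE('a) \<longleftrightarrow> (\<forall>n\<ge>1. finite_product_of P (poly_X ^ n))) \<and>
        (finite_product_of_indecomposable_rings TYPE('a) \<longleftrightarrow> (\<exists>n\<ge>1. finite_product_of P (poly_X ^ n)))"
    proof
      fix P assume "P \<in> {is_atom, indecomposable_poly :: 'a poly \<Rightarrow> bool}"
      then have "irreducible f \<Longrightarrow> P f" "f dvd poly_X ^ n \<Longrightarrow> P f \<Longrightarrow> f dvd 1 \<or> irreducible f" for f n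
        using irreducible_imp_atom irreducible_imp_indecomposable_poly
          atom_imp_irreducible indecomposable_poly_imp_irreducible by blast+
      then show "(finite_product_of_indecomposable_rings TYPE('a) \<longleftrightarrow> finite_product_of P poly_X) \<and>
          (finite_product_of_indecomposable_rings TYPE('a) \<longleftrightarrow> (\<forall>n\<ge>1. finite_product_of P (poly_X ^ n))) \<and>
          (finite_product_of_indecomposable_rings TYPE('a) \<longleftrightarrow> (\<exists>n\<ge>1. finite_product_of P (poly_X ^ n)))"
        by (rule poly_X_finite_product_equivalences)
    qed
    assume fin: "finite_product_of_indecomposable_rings TYPE('a)"
    show "unique_finite_product_of is_atom (poly_X :: 'a poly) \<and>
        unique_finite_product_of (\<lambda>f. \<not> f dvd 1 \<and> indecomposable_poly f) (poly_X :: 'a poly)"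
    proof
      show "unique_finite_product_of is_atom (poly_X :: 'a poly)"
        by (rule unique_finite_product_of_poly_X[OF fin irreducible_imp_atom unique(1)])
      show "unique_finite_product_of (\<lambda>f. \<not> f dvd 1 \<and> indecomposable_poly f) (poly_X :: 'a poly)"
        by (rule unique_finite_product_of_poly_X[OF fin nonunit_indecomposable unique(2)])
    qed
  qed
qed

end
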